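(* Let $q$ be an odd prime power, let $u\in\mathbb{F}_q$ be a quadratic non-residue in $\mathbb{F}_q$, and let $\alpha\in\mathbb{F}_{q^2}$ satisfy $\alpha^2=u$. Let $\gamma\in\mathbb{F}_{q^2}$. The polynomial $f(x)=x+\gamma\,\mathrm{Tr}\left(x^2+x^{q+1}\right)$ over $\mathbb{F}_{q^2}$ is a permutation polynomial if and only if $\alpha\gamma\in\mathbb{F}_q$.
   Context: $\mathrm{Tr}:\mathbb{F}_{q^2}\to\mathbb{F}_q$ is the trace map $\mathrm{Tr}(x)=x+x^q$. A polynomial $f$ over $\mathbb{F}_{q^2}$ is a permutation polynomial if the map $x\mapsto f(x)$ is a bijection of $\mathbb{F}_{q^2}$ onto itself. *)

theory Defs
  imports
    "HOL-Number_Theory.Prime_Powers"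
    "HOL-Algebra.Algebraic_Closure_Type"
begin

definition quadratic_nonresidue_in :: "'a::field set \<Rightarrow> 'a \<Rightarrow> bool" where
  "quadratic_nonresidue_in K u \<longleftrightarrow> u \<in> K \<and> (\<nexists>y. y \<in> K \<and> y ^ 2 = u)"

text \<open>The formula of the trace from a field with \<open>q ^ 2\<close> elements to its subfield with
  \<open>q\<close> elements. It is polymorphic so that it can also be applied to polynomials over the field,
  with \<open>poly (Tr q g) x = Tr q (poly g x)\<close>.\<close>

definition Tr :: "nat \<Rightarrow> 'a::comm_semiring_1 \<Rightarrow> 'a" where
  "Tr q x = x + x ^ q"

lemma poly_Tr: "poly (Tr q g) x = Tr q (poly g x)"
  by (simp add: Tr_def)

definition permutation_poly :: "'a::field poly \<Rightarrow> bool" where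
  "permutation_poly f \<longleftrightarrow> bij (poly f)"

definition trace_perturbed_X :: "nat \<Rightarrow> 'a::field \<Rightarrow> 'a poly" where
  "trace_perturbed_X q \<gamma> =
     monom 1 1 + smult \<gamma> (Tr q (monom 1 2 + monom 1 (q + 1)))"

lemma poly_trace_perturbed_X:
  "poly (trace_perturbed_X q \<gamma>) x = x + \<gamma> * Tr q (x ^ 2 + x ^ (q + 1))"
  by (simp add: trace_perturbed_X_def poly_Tr poly_monom)

end

theory Submission
  imports Defs
begin

text \<open>With \<open>T = Tr x\<close> we have \<open>x^2 + x^(q+1) = x T\<close>, and \<open>T\<close> lies in the subfield, so
  \<open>f x = x + \<gamma> T^2\<close> and hence \<open>Tr (f x) = T + Tr \<gamma> T^2\<close>. If \<open>Tr \<gamma> = 0\<close>, then \<open>f x\<close> determines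
  \<open>T\<close> and therefore \<open>x\<close>. If \<open>c = Tr \<gamma> \<noteq> 0\<close>, then \<open>- \<gamma> / c^2\<close> is a second zero of \<open>f\<close> besides \<open>0\<close>.
  Since \<open>\<alpha>^q = - \<alpha>\<close>, the condition \<open>Tr \<gamma> = 0\<close> says that \<open>\<alpha> \<gamma>\<close> is fixed by the Frobenius map.\<close>

text \<open>Translation by 1 permutes the ring, so the sum of all elements does not change when 1 is
  added to each summand.\<close>

lemma of_nat_card_UNIV_eq_0: "of_nat (card (UNIV :: 'a set)) = (0 :: 'a::{finite, ring_1})"
proof -
  have "(\<Sum>x\<in>UNIV. x :: 'a) = (\<Sum>x\<in>UNIV. x + 1)"
    by (rule sum.reindex_bij_witness[of _ "\<lambda>x. x + 1" "\<lambda>x. x - 1"]) auto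
  then show ?thesis
    by (simp add: sum.distrib)
qed

lemma CHAR_eq_if_card_UNIV_prime_power:
  assumes "normalization_semidom_class.prime p" and "card (UNIV :: 'a::finite_field set) = p ^ n"
  shows "CHAR('a) = p"
proof -
  have "CHAR('a) dvd p ^ n"
    using of_nat_card_UNIV_eq_0[where 'a = 'a] assms(2) of_nat_eq_0_iff_char_dvd by metis
  then show ?thesis
    using assms(1) CHAR_prime prime_dvd_power primes_dvd_imp_eq by blast
qed

text \<open>Fermat's argument: multiplication by a nonzero \<open>x\<close> permutes
  \<open>K - {0}\<close>, so the product of the nonzero elements of \<open>K\<close> can be
  cancelled.\<close>

lemma power_card_eq_same_if_mult_closed:
  fixes K :: "'a::field set"
  assumes "finite K" and "0 \<in> K" and closed: "\<And>x y. x \<in> K \<Longrightarrow> y \<in> K \<Longrightarrow> x * y \<in> K"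
    and "x \<in> K"
  shows "x ^ card K = x"
proof (cases "x = 0")
  case True
  then show ?thesis
    using assms(1,2) by (auto simp: power_0_left)
next
  case False
  let ?K = "K - {0}"
  have inj: "inj_on (\<lambda>y. x * y) ?K"
    using False by (auto simp: inj_on_def)
  have "(\<lambda>y. x * y) ` ?K = ?K"
    using assms False inj by (intro endo_inj_surj) auto
  then have "prod id ?K = (\<Prod>y\<in>?K. x * y)"
    using prod.reindex[OF inj, of id] by simp
  also have "\<dots> = x ^ card ?K * prod id ?K"
    by (simp add: prod.distrib)
  finally have "x ^ card ?K = 1"
    using \<open>finite K\<close> by simp
  moreover have "card K = Suc (card ?K)"
    using assms(1,2) by (metis card.remove)
  ultimately show ?thesis
    by simp
qed

text \<open>By Fermat's argument, \<open>K\<close> consists of roots of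
  \<open>X ^ card K - X\<close>, which has at most \<open>card K\<close> roots. This turns
  membership in the subfield into an equation.\<close>

lemma finite_subfield_eq_power_fixed_points:
  fixes K :: "'a::field set"
  assumes "subfield K (ring_of_type_algebra :: 'a ring)" and "finite K"
  shows "K = {x. x ^ card K = x}"
proof (rule card_subset_eq[OF _ _ antisym])
  let ?R = "{x :: 'a. x ^ card K = x}"
  note sub = subringE[OF subfieldE(1)[OF assms(1)]]
  have zero: "0 \<in> K" and one: "1 \<in> K"
    using sub(2,3) by (simp_all add: ring_of_type_algebra_def)
  have closed: "x * y \<in> K" if "x \<in> K" "y \<in> K" for x y
    using sub(6)[OF that] by (simp add: ring_of_type_algebra_def)
  show incl: "K \<subseteq> ?R"
    using power_card_eq_same_if_mult_closed[OF assms(2) zero closed] by blast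
  \<comment> \<open>With \<open>card K > 1\<close> the two monomials of \<open>?p\<close> have
    different degrees, so \<open>?p\<close> is nonzero and its degree bounds the number of
    roots.\<close>
  have "card {0 :: 'a, 1} \<le> card K"
    using zero one assms(2) by (intro card_mono) auto
  then have q: "1 < card K"
    by simp
  let ?p = "monom 1 (card K) - monom 1 1 :: 'a poly"
  have "coeff ?p (card K) = 1"
    using q by simp
  then have nz: "?p \<noteq> 0"
    by (metis coeff_0 zero_neq_one)
  have roots: "?R = {x. poly ?p x = 0}"
    by (simp add: poly_monom)
  show fin: "finite ?R"
    unfolding roots by (rule poly_roots_finite[OF nz])
  show "card K \<le> card ?R"
    by (rule card_mono[OF fin incl])
  have "degree ?p \<le> card K"
    using q by (intro degree_diff_le) (auto simp: degree_monom_eq)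
  then show "card ?R \<le> card K"
    unfolding roots using card_poly_roots_bound[OF nz] by (rule order_trans[rotated])
qed

theorem corollary3p1:
  fixes q :: nat
    and Fq :: "'a::finite_field set"
    and u \<alpha> \<gamma> :: 'a
  assumes "primepow q" and "odd q"
    and "card (UNIV :: 'a set) = q ^ 2"
    and "subfield Fq (ring_of_type_algebra :: 'a ring)" and "card Fq = q"
    and "quadratic_nonresidue_in Fq u"
    and "\<alpha> ^ 2 = u"
  shows "permutation_poly (trace_perturbed_X q \<gamma>) \<longleftrightarrow> \<alpha> * \<gamma> \<in> Fq"
proof -
  obtain p k where p: "normalization_semidom_class.prime p" and q: "q = p ^ k"
    using \<open>primepow q\<close> by (auto simp: primepow_def)
  have "CHAR('a) = p"
    using p assms(3) q by (intro CHAR_eq_if_card_UNIV_prime_power) (simp_all flip: power_mult)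
  then have add_pow: "(x + y) ^ q = x ^ q + y ^ q" for x y :: 'a
    using freshmans_dream'[of q k x y] p q by simp
  \<comment> \<open>The \<open>q\<close>-th power map is an involution, so it swaps the two summands
    of \<open>Tr q x\<close>.\<close>
  have pow_pow: "(x ^ q) ^ q = x" for x :: 'a
    using finite_field_power_card_eq_same[of x] assms(3)
    by (simp add: power2_eq_square power_mult)
  have Fq_iff: "x \<in> Fq \<longleftrightarrow> x ^ q = x" for x
    using finite_subfield_eq_power_fixed_points[OF assms(4)] assms(5) by auto
  have Tr_pow: "Tr q x ^ q = Tr q x" for x :: 'a
    by (simp add: Tr_def add_pow pow_pow add.commute)
  have Tr_add: "Tr q (x + y) = Tr q x + Tr q y" for x y :: 'a
    by (simp add: Tr_def add_pow)
  have Tr_scale: "Tr q (x * c) = Tr q x * c" if "c ^ q = c" for x c :: 'a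
    by (simp add: Tr_def that power_mult_distrib algebra_simps)
  have f: "poly (trace_perturbed_X q \<gamma>) x = x + \<gamma> * Tr q x ^ 2" for x
  proof -
    have "x ^ 2 + x ^ (q + 1) = x * Tr q x"
      by (simp add: Tr_def power2_eq_square algebra_simps)
    then show ?thesis
      by (simp only: poly_trace_perturbed_X Tr_scale[OF Tr_pow] power2_eq_square)
  qed
  have Tr_f: "Tr q (poly (trace_perturbed_X q \<gamma>) x) = Tr q x + Tr q \<gamma> * Tr q x ^ 2" for x
  proof -
    have "(Tr q x ^ 2) ^ q = Tr q x ^ 2"
      by (metis Tr_pow power_mult mult.commute)
    then show ?thesis
      by (simp add: f Tr_add Tr_scale)
  qed
  have perm_iff: "permutation_poly (trace_perturbed_X q \<gamma>) \<longleftrightarrow> Tr q \<gamma> = 0"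
  proof
    assume "permutation_poly (trace_perturbed_X q \<gamma>)"
    then have inj: "inj (poly (trace_perturbed_X q \<gamma>))"
      by (simp add: permutation_poly_def bij_is_inj)
    show "Tr q \<gamma> = 0"
    proof (rule ccontr)
      define c where "c = Tr q \<gamma>"
      assume "Tr q \<gamma> \<noteq> 0"
      then have c: "c \<noteq> 0" "c ^ q = c"
        by (simp_all add: c_def Tr_pow)
      \<comment> \<open>For \<open>d\<close> fixed by the \<open>q\<close>-th power map,
        \<open>Tr q (\<gamma> * d) = c * d\<close>, so \<open>f\<close> maps
        \<open>\<gamma> * d\<close> to \<open>\<gamma> * (d + c ^ 2 * d ^ 2)\<close>. This choice of
        \<open>d\<close> makes the bracket vanish.\<close>
      define d where "d = - 1 / c ^ 2"
      have "q > 0"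
        using \<open>odd q\<close> by (rule odd_pos)
      have "d ^ q = (- 1) ^ q / (c ^ q) ^ 2"
        unfolding d_def power_divide by (metis power_mult mult.commute)
      \<comment> \<open>Oddness of \<open>q\<close> enters through
        \<open>(- 1) ^ q = - 1\<close>.\<close>
      then have "d ^ q = d"
        using c \<open>odd q\<close> by (simp add: d_def)
      then have "Tr q (\<gamma> * d) = - 1 / c"
        using c by (simp add: Tr_scale flip: c_def) (simp add: d_def power2_eq_square)
      then have "poly (trace_perturbed_X q \<gamma>) (\<gamma> * d) = 0"
        by (simp add: f d_def power_divide)
      also have "0 = poly (trace_perturbed_X q \<gamma>) 0"
        using \<open>q > 0\<close> by (simp add: f Tr_def)
      finally have "\<gamma> * d = 0"
        by (rule injD[OF inj])
      then have "\<gamma> = 0"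
        using c by (simp add: d_def)
      with c(1) \<open>q > 0\<close> show False
        by (simp add: c_def Tr_def)
    qed
  next
    assume tr: "Tr q \<gamma> = 0"
    have "inj (poly (trace_perturbed_X q \<gamma>))"
    proof (rule injI)
      fix x y
      assume eq: "poly (trace_perturbed_X q \<gamma>) x = poly (trace_perturbed_X q \<gamma>) y"
      then have "Tr q x = Tr q y"
        using Tr_f[of x] Tr_f[of y] tr by simp
      with eq show "x = y"
        by (simp add: f)
    qed
    then show "permutation_poly (trace_perturbed_X q \<gamma>)"
      unfolding permutation_poly_def by (simp add: bij_def finite_UNIV_inj_surj)
  qed
  have "\<alpha> \<notin> Fq" and u: "u ^ q = u"
    using assms(6,7) by (auto simp: quadratic_nonresidue_in_def Fq_iff)
  \<comment> \<open>Both \<open>\<alpha> ^ q\<close> and \<open>\<alpha>\<close> are square roots of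
    \<open>u\<close>, so they agree up to sign. Equality would put \<open>\<alpha>\<close> into
    \<open>Fq\<close> and make \<open>u\<close> a square there.\<close>
  have "(\<alpha> ^ q) ^ 2 = \<alpha> ^ 2"
    using u assms(7) by (metis power_mult mult.commute)
  then have \<alpha>_pow: "\<alpha> ^ q = - \<alpha>"
    using \<open>\<alpha> \<notin> Fq\<close> by (auto simp: power2_eq_iff Fq_iff)
  have "\<alpha> \<noteq> 0"
    using \<open>\<alpha> \<notin> Fq\<close> odd_pos[OF \<open>odd q\<close>] by (auto simp: Fq_iff power_0_left)
  have "\<alpha> * \<gamma> \<in> Fq \<longleftrightarrow> \<alpha> * (- (\<gamma> ^ q)) = \<alpha> * \<gamma>"
    by (simp add: Fq_iff power_mult_distrib \<alpha>_pow)
  also have "\<dots> \<longleftrightarrow> Tr q \<gamma> = 0"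
    unfolding mult_left_cancel[OF \<open>\<alpha> \<noteq> 0\<close>]
    by (auto simp: Tr_def eq_neg_iff_add_eq_0 eq_commute[of _ \<gamma>])
  finally show ?thesis
    using perm_iff by simp
qed

end
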